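(* Let $(\mathcal{T}_n)_{n\ge1}$ be a sequence of size-conditioned simply generated trees of type I, II or III, and let $v_n$ be a uniformly chosen vertex of $\mathcal{T}_n$. There is $n_0\ge1$, depending only on the weight sequence, such that for every $p\ge0$, \[ \sup_{n\ge n_0}\mathbf E\bigl[\partial_{\mathrm p}(\mathcal{T}_n,v_n)^p\bigr]<+\infty, \] and the family $\{\partial_{\mathrm p}(\mathcal{T}_n,v_n)\}_{n\ge1}$ is uniformly integrable of every order; that is, for every real $p\ge 0$ the family $\{\partial_{\mathrm p}(\mathcal{T}_n,v_n)^p\}_{n\ge1}$ is uniformly integrable (here $n$ ranges only over values for which $\mathcal{T}_n$ is defined).
   Context: **Simply generated trees.** A weight sequence is a sequence $\mathbf w=(\omega_k)_{k\ge0}$ of non-negative reals with $\omega_0>0$ and $\omega_k>0$ for at least one $k\ge2$. For $n\ge 1$, $\mathcal{T}_n$ is the random rooted plane tree with $n$ vertices such that $\mathbf P(\mathcal{T}_n=T)$ is proportional to $\prod_{v\in T}\omega_{d_T^+(v)}$ for each $n$-vertex rooted plane tree $T$, where $d_T^+(v)$ is the outdegree (number of children) of $v$. Throughout, only those $n$ are considered for which some $n$-vertex tree has positive weight ("$\mathcal{T}_n$ is defined"). The vertex $v_n$ is uniform among the vertices of $\mathcal{T}_n$, conditionally on $\mathcal{T}_n$. **Types.** Let $\Phi(z)=\sum_{k\ge0}\omega_kz^k$ with radius of convergence $R\in[0,\infty]$. Type I: there is a (finite) $\tau\in(0,R]$ with $\Phi(\tau)<\infty$ and $\tau\Phi'(\tau)/\Phi(\tau)=1$.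 Type II: $R>0$, $\Phi(R)<\infty$ and $R\Phi'(R)/\Phi(R)<1$. Type III: $R=0$. **Protection number.** A leaf is a vertex with no children. For a vertex $v$ of a finite rooted tree $T$, the protection number $\partial_{\mathrm p}(T,v)$ is the minimal graph distance from $v$ to a leaf of the fringe subtree of $T$ at $v$ (the subtree consisting of $v$ and all its descendants). *)

theory Defs
  imports "HOL-Probability.Probability"
begin

section \<open>Rooted plane trees\<close>

datatype plane_tree = Node (children: "plane_tree list")

text \<open>
  Vertices are addressed in Ulam--Harris fashion: the root is \<open>[]\<close>, and \<open>i # v\<close> is the vertex
  with address \<open>v\<close> in the subtree of the \<open>i\<close>-th child of the root (counting from 0).
\<close>

primrec is_vertex :: "plane_tree \<Rightarrow> nat list \<Rightarrow> bool" where
  "is_vertex T [] = True"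
| "is_vertex T (i # v) = (i < length (children T) \<and> is_vertex (children T ! i) v)"

definition vertices :: "plane_tree \<Rightarrow> nat list set" where
  "vertices T = {v. is_vertex T v}"

primrec fringe_subtree :: "plane_tree \<Rightarrow> nat list \<Rightarrow> plane_tree" where
  "fringe_subtree T [] = T"
| "fringe_subtree T (i # v) = fringe_subtree (children T ! i) v"

definition outdegree :: "plane_tree \<Rightarrow> nat list \<Rightarrow> nat" where
  "outdegree T v = length (children (fringe_subtree T v))"

definition leaves :: "plane_tree \<Rightarrow> nat list set" where
  "leaves T = {v \<in> vertices T. outdegree T v = 0}"

definition num_vertices :: "plane_tree \<Rightarrow> nat" where
  "num_vertices T = card (vertices T)"

definition adjacency :: "plane_tree \<Rightarrow> (nat list \<times> nat list) set" where
  "adjacency T = {(u, v). u \<in> vertices T \<and> v \<in> vertices T \<and> (\<exists>i. v = u @ [i] \<or> u = v @ [i])}"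

text \<open>Length of a shortest walk in the underlying undirected graph.\<close>

definition graph_dist :: "plane_tree \<Rightarrow> nat list \<Rightarrow> nat list \<Rightarrow> nat" where
  "graph_dist T u v = (LEAST k. (u, v) \<in> adjacency T ^^ k)"

text \<open>The vertex \<open>v\<close> of \<open>T\<close> has address \<open>[]\<close> in its own fringe subtree.\<close>

definition protection_number :: "plane_tree \<Rightarrow> nat list \<Rightarrow> nat" where
  "protection_number T v =
     Min (graph_dist (fringe_subtree T v) [] ` leaves (fringe_subtree T v))"


section \<open>Simply generated trees\<close>

definition weight_sequence :: "(nat \<Rightarrow> real) \<Rightarrow> bool" where
  "weight_sequence \<omega> \<longleftrightarrow> (\<forall>k. \<omega> k \<ge> 0) \<and> \<omega> 0 > 0 \<and> (\<exists>k\<ge>2. \<omega> k > 0)"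

definition tree_weight :: "(nat \<Rightarrow> real) \<Rightarrow> plane_tree \<Rightarrow> real" where
  "tree_weight \<omega> T = (\<Prod>v\<in>vertices T. \<omega> (outdegree T v))"

definition sg_defined :: "(nat \<Rightarrow> real) \<Rightarrow> nat \<Rightarrow> bool" where
  "sg_defined \<omega> n \<longleftrightarrow> (\<exists>T. num_vertices T = n \<and> tree_weight \<omega> T > 0)"

definition partition_function :: "(nat \<Rightarrow> real) \<Rightarrow> nat \<Rightarrow> real" where
  "partition_function \<omega> n = (\<Sum>T | num_vertices T = n. tree_weight \<omega> T)"

text \<open>
  The law of \<open>\<T>\<^sub>n\<close>; meaningful only if \<open>sg_defined \<omega> n\<close>
  (see \<open>pmf_sg_tree\<close> and \<open>finite_num_vertices_eq\<close> below).
\<close>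

definition sg_tree :: "(nat \<Rightarrow> real) \<Rightarrow> nat \<Rightarrow> plane_tree pmf" where
  "sg_tree \<omega> n = embed_pmf (\<lambda>T. if num_vertices T = n
     then tree_weight \<omega> T / partition_function \<omega> n else 0)"

text \<open>The joint law of \<open>(\<T>\<^sub>n, v\<^sub>n)\<close>.\<close>

definition sg_tree_vertex :: "(nat \<Rightarrow> real) \<Rightarrow> nat \<Rightarrow> (plane_tree \<times> nat list) pmf" where
  "sg_tree_vertex \<omega> n =
     bind_pmf (sg_tree \<omega> n) (\<lambda>T. map_pmf (\<lambda>v. (T, v)) (pmf_of_set (vertices T)))"


section \<open>Types of weight sequences\<close>

text \<open>
  All quantities live in \<open>[0, \<infinity>]\<close>, so that the power series may be evaluated at the radius of
  convergence. The derivative is the termwise one; at \<open>z = R\<close> this is the left derivative,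
  which may be infinite. If \<open>R = \<infinity>\<close> then \<open>\<Phi>(R) = \<infinity>\<close>, as some \<open>\<omega>\<^sub>k\<close> with \<open>k \<ge> 2\<close> is positive.
\<close>

definition gen_fun :: "(nat \<Rightarrow> real) \<Rightarrow> ennreal \<Rightarrow> ennreal" where
  "gen_fun \<omega> z = (\<Sum>k. ennreal (\<omega> k) * z ^ k)"

definition gen_fun_deriv :: "(nat \<Rightarrow> real) \<Rightarrow> ennreal \<Rightarrow> ennreal" where
  "gen_fun_deriv \<omega> z = gen_fun (diffs \<omega>) z"

definition radius :: "(nat \<Rightarrow> real) \<Rightarrow> ennreal" where
  "radius \<omega> = e2ennreal (conv_radius \<omega>)"

definition type_I :: "(nat \<Rightarrow> real) \<Rightarrow> bool" where
  "type_I \<omega> \<longleftrightarrow> (\<exists>\<tau>. 0 < \<tau> \<and> \<tau> < \<infinity> \<and> \<tau> \<le> radius \<omega> \<and> gen_fun \<omega> \<tau> < \<infinity> \<and>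
     \<tau> * gen_fun_deriv \<omega> \<tau> / gen_fun \<omega> \<tau> = 1)"

definition type_II :: "(nat \<Rightarrow> real) \<Rightarrow> bool" where
  "type_II \<omega> \<longleftrightarrow> radius \<omega> > 0 \<and> gen_fun \<omega> (radius \<omega>) < \<infinity> \<and>
     radius \<omega> * gen_fun_deriv \<omega> (radius \<omega>) / gen_fun \<omega> (radius \<omega>) < 1"

definition type_III :: "(nat \<Rightarrow> real) \<Rightarrow> bool" where
  "type_III \<omega> \<longleftrightarrow> radius \<omega> = 0"


section \<open>Moments and uniform integrability\<close>

text \<open>
  Real powers of non-negative reals with \<open>0\<^sup>0 = 1\<close>, whereas \<open>0 powr 0 = 0\<close> in the library.
\<close>

definition rpow :: "real \<Rightarrow> real \<Rightarrow> real" where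
  "rpow x p = (if p = 0 then 1 else x powr p)"

text \<open>The random variables of the family may live on different probability spaces.\<close>

definition uniformly_integrable ::
    "'i set \<Rightarrow> ('i \<Rightarrow> 'a measure) \<Rightarrow> ('i \<Rightarrow> 'a \<Rightarrow> real) \<Rightarrow> bool" where
  "uniformly_integrable I M X \<longleftrightarrow>
     (\<forall>i\<in>I. X i \<in> borel_measurable (M i)) \<and>
     ((\<lambda>K::real. SUP i\<in>I. \<integral>\<^sup>+x. ennreal \<bar>X i x\<bar> * indicator {x. \<bar>X i x\<bar> > K} x \<partial>M i)
        \<longlongrightarrow> 0) at_top"


section \<open>Well-definedness of the random tree\<close>

lemma Nil_in_vertices [simp]: "[] \<in> vertices T"
  by (simp add: vertices_def)

lemma vertices_Node:
  "vertices (Node ts) = insert [] (\<Union>i<length ts. (#) i ` vertices (ts ! i))"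
proof (rule set_eqI)
  fix v show "v \<in> vertices (Node ts) \<longleftrightarrow>
      v \<in> insert [] (\<Union>i<length ts. (#) i ` vertices (ts ! i))"
    by (cases v) (auto simp: vertices_def)
qed

lemma finite_vertices [simp]: "finite (vertices T)"
  by (induction T) (auto simp: vertices_Node)

lemma finite_num_vertices_le: "finite {T. num_vertices T \<le> n}"
proof (induction n)
  case 0
  have "num_vertices T > 0" for T
    by (auto simp: num_vertices_def card_gt_0_iff intro: Nil_in_vertices)
  then have "{T. num_vertices T \<le> 0} = {}" by (auto simp: not_le)
  then show ?case by (simp only: finite.emptyI)
next
  case (Suc n)
  have "{T. num_vertices T \<le> Suc n} \<subseteq>
      Node ` {ts. set ts \<subseteq> {T. num_vertices T \<le> n} \<and> length ts \<le> n}"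
  proof
    fix T assume "T \<in> {T. num_vertices T \<le> Suc n}"
    moreover obtain ts where T: "T = Node ts" by (cases T)
    ultimately have *: "card (vertices (Node ts) - {[]}) \<le> n"
      by (simp add: num_vertices_def)
    have sub: "(#) i ` vertices (ts ! i) \<subseteq> vertices (Node ts) - {[]}" if "i < length ts" for i
      using that by (auto simp: vertices_Node)
    have "num_vertices (ts ! i) \<le> n" if "i < length ts" for i
    proof -
      have "num_vertices (ts ! i) = card ((#) i ` vertices (ts ! i))"
        by (simp add: num_vertices_def card_image)
      also have "\<dots> \<le> card (vertices (Node ts) - {[]})"
        by (intro card_mono sub that) simp
      finally show ?thesis using * by simp
    qed
    moreover have "length ts \<le> n"
    proof -
      have "length ts = card ((\<lambda>i. [i]) ` {..<length ts})"
        by (simp add: card_image inj_on_def)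
      also have "\<dots> \<le> card (vertices (Node ts) - {[]})"
        by (intro card_mono) (auto simp: vertices_Node)
      finally show ?thesis using * by simp
    qed
    ultimately show "T \<in> Node ` {ts. set ts \<subseteq> {T. num_vertices T \<le> n} \<and> length ts \<le> n}"
      unfolding T by (intro imageI) (auto simp: in_set_conv_nth)
  qed
  then show ?case
    using finite_lists_length_le[OF Suc.IH] by (rule finite_subset[OF _ finite_imageI])
qed

lemma finite_num_vertices_eq: "finite {T. num_vertices T = n}"
  by (rule finite_subset[OF _ finite_num_vertices_le[of n]]) auto

lemma pmf_sg_tree:
  assumes "weight_sequence \<omega>" "sg_defined \<omega> n"
  shows "pmf (sg_tree \<omega> n) T =
    (if num_vertices T = n then tree_weight \<omega> T / partition_function \<omega> n else 0)"
proof -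
  let ?A = "{T. num_vertices T = n}"
  let ?f = "\<lambda>T. if num_vertices T = n then tree_weight \<omega> T / partition_function \<omega> n else 0"
  have nn: "tree_weight \<omega> T \<ge> 0" for T
    using assms(1) by (auto simp: tree_weight_def weight_sequence_def intro: prod_nonneg)
  obtain T0 where T0: "T0 \<in> ?A" "tree_weight \<omega> T0 > 0"
    using assms(2) by (auto simp: sg_defined_def)
  have pos: "partition_function \<omega> n > 0"
    unfolding partition_function_def
    using T0 by (intro sum_pos2[where i = T0] finite_num_vertices_eq) (simp_all add: nn)
  have "(\<integral>\<^sup>+T. ennreal (?f T) \<partial>count_space UNIV) = (\<Sum>T\<in>?A. ennreal (?f T))"
    by (rule nn_integral_count_space') (auto simp: finite_num_vertices_eq)
  also have "\<dots> = ennreal (\<Sum>T\<in>?A. tree_weight \<omega> T / partition_function \<omega> n)"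
    using pos nn by (subst sum_ennreal[symmetric]) (auto intro!: sum.cong)
  also have "\<dots> = 1"
    using pos by (simp add: sum_divide_distrib[symmetric] partition_function_def)
  finally show ?thesis
    unfolding sg_tree_def using pos nn by (subst pmf_embed_pmf) auto
qed

end

theory Submission
  imports Defs "HOL-Real_Asymp.Real_Asymp"
begin

text \<open>
  Write \<open>a = \<omega>\<^sub>1\<close>, let \<open>Z\<^sub>n\<close> be the partition function, and let \<open>r(v)\<close> be the number of
  consecutive vertices of outdegree 1 met when descending from \<open>v\<close>.
  Outside such unary runs the tree branches at least twice, so large protection numbers are
  rare; an induction on the tree with a suitable potential gives the deterministic bound
  \<open>\<Sum>\<^sub>v \<partial>\<^sub>p(T, v)\<^sup>p \<le> C \<Sum>\<^sub>v (1 + r(v)\<^sup>p\<^sup>+\<^sup>1)\<close>.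
  Cutting out a run of length \<open>j\<close> is a bijection showing that the expected number of \<open>v\<close>
  with \<open>r(v) \<ge> j\<close> in \<open>\<T>\<^sub>n\<close> is \<open>a\<^sup>j (n - j) Z\<^sub>n\<^sub>-\<^sub>j / Z\<^sub>n\<close>.
  Similarly, inserting a vertex of outdegree \<open>k \<ge> 2\<close> that has \<open>k - 1\<close> leaf children, and
  counting unary vertices, yields \<open>b m Z\<^sub>m + a (n - 1) Z\<^sub>n\<^sub>-\<^sub>1 \<le> n Z\<^sub>n\<close> for \<open>n = m + k\<close>
  and some \<open>b > 0\<close>. Hence \<open>Z\<^sub>n / a\<^sup>n\<close> grows by a definite factor every \<open>k\<close> steps, and
  \<open>a\<^sup>j Z\<^sub>n\<^sub>-\<^sub>j / Z\<^sub>n\<close> decays geometrically in \<open>j\<close>, uniformly in \<open>n\<close>.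
\<close>

section \<open>Plane trees\<close>

lemma sum_vertices_Node:
  "(\<Sum>v\<in>vertices (Node ts). f v) =
     f [] + (\<Sum>i<length ts. \<Sum>v\<in>vertices (ts ! i). f (i # v))"
proof -
  have "(\<Sum>v\<in>vertices (Node ts). f v) =
      f [] + (\<Sum>v\<in>(\<Union>i<length ts. (#) i ` vertices (ts ! i)). f v)"
    unfolding vertices_Node by (subst sum.insert) auto
  also have "(\<Sum>v\<in>(\<Union>i<length ts. (#) i ` vertices (ts ! i)). f v) =
      (\<Sum>i<length ts. \<Sum>v\<in>(#) i ` vertices (ts ! i). f v)"
    by (rule sum.UNION_disjoint) auto
  also have "\<dots> = (\<Sum>i<length ts. \<Sum>v\<in>vertices (ts ! i). f (i # v))"
    by (simp add: sum.reindex)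
  finally show ?thesis .
qed

lemma prod_vertices_Node:
  "(\<Prod>v\<in>vertices (Node ts). f v) =
     f [] * (\<Prod>i<length ts. \<Prod>v\<in>vertices (ts ! i). f (i # v))"
proof -
  have "(\<Prod>v\<in>vertices (Node ts). f v) =
      f [] * (\<Prod>v\<in>(\<Union>i<length ts. (#) i ` vertices (ts ! i)). f v)"
    unfolding vertices_Node by (subst prod.insert) auto
  also have "(\<Prod>v\<in>(\<Union>i<length ts. (#) i ` vertices (ts ! i)). f v) =
      (\<Prod>i<length ts. \<Prod>v\<in>(#) i ` vertices (ts ! i). f v)"
    by (rule prod.UNION_disjoint) auto
  also have "\<dots> = (\<Prod>i<length ts. \<Prod>v\<in>vertices (ts ! i). f (i # v))"
    by (simp add: prod.reindex)
  finally show ?thesis .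
qed

text \<open>The additive functional of a tree with toll function \<open>g\<close>. Vertex counts and
  sums over all vertices take this form, and \<open>fringe_sum_Node\<close> gives the recursion used
  in inductions on the tree.\<close>

definition fringe_sum :: "(plane_tree \<Rightarrow> 'a::comm_monoid_add) \<Rightarrow> plane_tree \<Rightarrow> 'a" where
  "fringe_sum g T = (\<Sum>v\<in>vertices T. g (fringe_subtree T v))"

lemma fringe_sum_Node: "fringe_sum g (Node ts) = g (Node ts) + sum_list (map (fringe_sum g) ts)"
  by (simp add: fringe_sum_def sum_vertices_Node sum_list_sum_nth atLeast0LessThan)

lemma num_vertices_fringe_sum: "num_vertices T = fringe_sum (\<lambda>_. 1) T"
  by (simp add: num_vertices_def fringe_sum_def)

lemma num_vertices_Node: "num_vertices (Node ts) = 1 + sum_list (map num_vertices ts)"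
  by (simp add: num_vertices_fringe_sum[abs_def] fringe_sum_Node)

lemma tree_weight_Node:
  "tree_weight \<omega> (Node ts) = \<omega> (length ts) * prod_list (map (tree_weight \<omega>) ts)"
  by (simp add: tree_weight_def prod_vertices_Node prod.list_conv_set_nth atLeast0LessThan
      outdegree_def)

lemma num_vertices_pos: "0 < num_vertices T"
  by (cases T) (simp add: num_vertices_Node)

section \<open>Leaf heights and unary runs\<close>

fun leaf_height :: "plane_tree \<Rightarrow> nat" where
  "leaf_height (Node ts) = (if ts = [] then 0 else Suc (Min (leaf_height ` set ts)))"

declare leaf_height.simps [simp del]

fun unary_run :: "plane_tree \<Rightarrow> nat" where
  "unary_run (Node [t]) = Suc (unary_run t)"
| "unary_run (Node []) = 0"
| "unary_run (Node (t # t' # ts)) = 0"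

lemma leaf_height_Nil [simp]: "leaf_height (Node []) = 0"
  by (simp add: leaf_height.simps)

lemma leaf_height_unary [simp]: "leaf_height (Node [t]) = Suc (leaf_height t)"
  by (simp add: leaf_height.simps)

lemma leaf_height_le: "t \<in> set ts \<Longrightarrow> leaf_height (Node ts) \<le> Suc (leaf_height t)"
  by (auto simp: leaf_height.simps)

lemma unary_run_eq_0: "length ts \<noteq> 1 \<Longrightarrow> unary_run (Node ts) = 0"
  by (cases "Node ts" rule: unary_run.cases) auto

lemma unary_run_le_leaf_height: "unary_run T \<le> leaf_height T"
  by (induction T rule: unary_run.induct) auto

lemma unary_run_less_num_vertices: "unary_run T < num_vertices T"
  by (induction T rule: unary_run.induct) (auto simp: num_vertices_Node)

text \<open>Descending each time into a child of minimal \<open>leaf_height\<close> ends in a leaf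
  at exactly that depth.\<close>

lemma leaf_at_leaf_height: "\<exists>v\<in>leaves T. length v = leaf_height T"
proof (induction T rule: leaf_height.induct)
  case (1 ts)
  show ?case
  proof (cases "ts = []")
    case True
    then show ?thesis by (auto simp: leaves_def outdegree_def)
  next
    case False
    then have "Min (leaf_height ` set ts) \<in> leaf_height ` set ts" by simp
    then obtain t where t: "t \<in> set ts" "Min (leaf_height ` set ts) = leaf_height t" by auto
    then obtain i where i: "i < length ts" "ts ! i = t" by (auto simp: in_set_conv_nth)
    obtain v where "v \<in> leaves t" "length v = leaf_height t" using 1[OF False t(1)] by blast
    then show ?thesis using i t False
      by (intro bexI[of _ "i # v"]) (auto simp: leaves_def vertices_def outdegree_def leaf_height.simps)
  qed
qed

lemma is_vertex_append: "is_vertex T (u @ v) \<Longrightarrow> is_vertex T u"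
  by (induction u arbitrary: T) auto

text \<open>The prefixes of the address \<open>v\<close> form a walk from the root, one edge per
  letter; reverse induction fits because an edge appends a last letter.\<close>

lemma graph_dist_root_le:
  assumes "v \<in> vertices T"
  shows "graph_dist T [] v \<le> length v"
proof -
  have "is_vertex T v \<Longrightarrow> ([], v) \<in> adjacency T ^^ length v"
  proof (induction v rule: rev_induct)
    case (snoc i u)
    then have "is_vertex T u" by (metis is_vertex_append)
    with snoc show ?case
      by (auto simp: adjacency_def vertices_def intro!: relcompI[of _ u])
  qed simp
  then show ?thesis using assms
    unfolding graph_dist_def vertices_def by (auto intro: Least_le)
qed

text \<open>The leaf found at depth \<open>leaf_height\<close> is one competitor in the minimum.
  From here on the recursive \<open>leaf_height\<close> stands in for the graph distance.\<close>

lemma protection_number_le_leaf_height: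
  "protection_number T v \<le> leaf_height (fringe_subtree T v)"
proof -
  obtain u where u: "u \<in> leaves (fringe_subtree T v)" "length u = leaf_height (fringe_subtree T v)"
    using leaf_at_leaf_height by blast
  have fin: "finite (leaves (fringe_subtree T v))"
    by (rule finite_subset[OF _ finite_vertices[of "fringe_subtree T v"]]) (auto simp: leaves_def)
  have "protection_number T v \<le> graph_dist (fringe_subtree T v) [] u"
    unfolding protection_number_def using u fin by (intro Min_le) auto
  also have "\<dots> \<le> length u" using u by (intro graph_dist_root_le) (auto simp: leaves_def)
  finally show ?thesis using u by simp
qed

section \<open>Insertion into plane trees\<close>

primrec replace_at :: "nat list \<Rightarrow> plane_tree \<Rightarrow> plane_tree \<Rightarrow> plane_tree" where
  "replace_at [] T s = s"
| "replace_at (i # v) T s = Node ((children T)[i := replace_at v (children T ! i) s])"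

lemma is_vertex_replace_at: "is_vertex T v \<Longrightarrow> is_vertex (replace_at v T s) v"
  by (induction v arbitrary: T) auto

lemma fringe_replace_at: "is_vertex T v \<Longrightarrow> fringe_subtree (replace_at v T s) v = s"
  by (induction v arbitrary: T) auto

text \<open>Together with \<open>replace_at_fringe\<close>, this makes cutting out a piece the
  inverse of inserting it.\<close>

lemma replace_at_replace_at:
  "is_vertex T v \<Longrightarrow> replace_at v (replace_at v T s) s' = replace_at v T s'"
  by (induction v arbitrary: T) auto

lemma replace_at_fringe: "is_vertex T v \<Longrightarrow> replace_at v T (fringe_subtree T v) = T"
  by (induction v arbitrary: T) auto

lemma num_vertices_replace_at:
  assumes "is_vertex T v" "num_vertices s = num_vertices (fringe_subtree T v) + d"
  shows "num_vertices (replace_at v T s) = num_vertices T + d"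
  using assms
proof (induction v arbitrary: T)
  case (Cons i v)
  obtain ts where T: "T = Node ts" by (cases T)
  have i: "i < length ts" using Cons T by simp
  then have ts: "ts = take i ts @ ts ! i # drop (Suc i) ts" by (rule id_take_nth_drop)
  have IH: "num_vertices (replace_at v (ts ! i) s) = num_vertices (ts ! i) + d"
    using Cons T by simp
  have "num_vertices T =
      1 + sum_list (map num_vertices (take i ts @ ts ! i # drop (Suc i) ts))"
    using ts T by (simp add: num_vertices_Node)
  then show ?case
    using i IH by (simp add: T upd_conv_take_nth_drop num_vertices_Node)
qed simp

text \<open>Outdegrees outside the replaced subtree do not change, so the factor
  \<open>\<kappa>\<close> gained there passes through the product.\<close>

lemma tree_weight_replace_at:
  assumes "is_vertex T v" "tree_weight \<omega> s = \<kappa> * tree_weight \<omega> (fringe_subtree T v)"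
  shows "tree_weight \<omega> (replace_at v T s) = \<kappa> * tree_weight \<omega> T"
  using assms
proof (induction v arbitrary: T)
  case (Cons i v)
  obtain ts where T: "T = Node ts" by (cases T)
  have i: "i < length ts" using Cons T by simp
  obtain xs t ys where ts: "ts = xs @ t # ys" "length xs = i"
    using id_take_nth_drop[OF i] i by (metis length_take min.absorb4)
  have "tree_weight \<omega> (replace_at v t s) = \<kappa> * tree_weight \<omega> t"
    using Cons T ts by (auto simp: nth_append)
  then show ?case
    using ts by (auto simp: T tree_weight_Node nth_append list_update_append)
qed simp

text \<open>Double counting of marked trees: replacing the fringe subtree \<open>t\<close> at a
  marked vertex by \<open>c t\<close> is a bijection from marked trees of size \<open>m\<close> onto
  trees of size \<open>m + d\<close> marked at a vertex whose fringe subtree lies in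
  \<open>range c\<close>. The factor \<open>real m\<close> counts the marks.\<close>

lemma sum_weight_insert:
  assumes inj: "inj c"
    and num: "\<And>t. num_vertices (c t) = num_vertices t + d"
    and weight: "\<And>t. tree_weight \<omega> (c t) = \<kappa> * tree_weight \<omega> t"
  shows "(\<Sum>T | num_vertices T = m + d.
            tree_weight \<omega> T * fringe_sum (\<lambda>t. of_bool (t \<in> range c)) T) =
         \<kappa> * real m * partition_function \<omega> m"
proof -
  let ?A = "SIGMA T:{T. num_vertices T = m}. vertices T"
  let ?B = "SIGMA T:{T. num_vertices T = m + d}. {v\<in>vertices T. fringe_subtree T v \<in> range c}"
  let ?h = "\<lambda>(T, v). (replace_at v T (c (fringe_subtree T v)), v)"
  let ?g = "\<lambda>(T, v). (replace_at v T (inv c (fringe_subtree T v)), v)"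
  have bij: "bij_betw ?h ?A ?B"
  proof (rule bij_betwI[where g = ?g])
    show "?h \<in> ?A \<rightarrow> ?B"
      by (auto simp: vertices_def is_vertex_replace_at fringe_replace_at num
          num_vertices_replace_at)
    show "?g \<in> ?B \<rightarrow> ?A"
    proof (clarsimp simp: vertices_def is_vertex_replace_at)
      fix T v t assume T: "is_vertex T v" "num_vertices T = m + d" "fringe_subtree T v = c t"
      \<comment> \<open>The size of the reduced tree is found by reinserting \<open>c t\<close>,
        which restores \<open>T\<close> and adds \<open>d\<close>.\<close>
      let ?T = "replace_at v T t"
      have "replace_at v ?T (c t) = T"
        using T by (metis replace_at_replace_at replace_at_fringe)
      moreover have "num_vertices (replace_at v ?T (c t)) = num_vertices ?T + d"
        using T by (intro num_vertices_replace_at) (auto simp: is_vertex_replace_at fringe_replace_at num)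
      ultimately show "num_vertices (replace_at v T (inv c (c t))) = m"
        using T inj by simp
    qed
    show "?g (?h x) = x" if "x \<in> ?A" for x
      using that inj
      by (auto simp: vertices_def is_vertex_replace_at fringe_replace_at replace_at_replace_at
          replace_at_fringe)
    show "?h (?g y) = y" if "y \<in> ?B" for y
      using that inj
      by (clarsimp simp: vertices_def is_vertex_replace_at fringe_replace_at replace_at_replace_at)
         (metis replace_at_fringe)
  qed
  have "\<kappa> * real m * partition_function \<omega> m =
      (\<Sum>T | num_vertices T = m. \<Sum>v\<in>vertices T. \<kappa> * tree_weight \<omega> T)"
    by (simp add: partition_function_def sum_distrib_left num_vertices_def algebra_simps)
  also have "\<dots> = (\<Sum>(T, v)\<in>?A. \<kappa> * tree_weight \<omega> T)"
    by (subst sum.Sigma) (auto simp: finite_num_vertices_eq)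
  also have "\<dots> = (\<Sum>x\<in>?A. tree_weight \<omega> (fst (?h x)))"
    by (intro sum.cong) (auto simp: vertices_def weight intro!: tree_weight_replace_at[symmetric])
  also have "\<dots> = (\<Sum>x\<in>?B. tree_weight \<omega> (fst x))"
    by (rule sum.reindex_bij_betw[OF bij])
  also have "\<dots> = (\<Sum>T | num_vertices T = m + d.
      \<Sum>v\<in>{v\<in>vertices T. fringe_subtree T v \<in> range c}. tree_weight \<omega> T)"
    by (subst sum.Sigma) (auto simp: finite_num_vertices_eq split_def)
  also have "\<dots> = (\<Sum>T | num_vertices T = m + d.
            tree_weight \<omega> T * fringe_sum (\<lambda>t. of_bool (t \<in> range c)) T)"
    by (simp add: fringe_sum_def sum_of_bool_eq Int_def conj_commute mult.commute)
  finally show ?thesis ..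
qed

section \<open>Protection numbers and unary runs\<close>

text \<open>If \<open>y\<close> is at most a small multiple \<open>t * x\<close>, the excess is
  absorbed by \<open>1 + \<epsilon>\<close>; otherwise \<open>x < y / t\<close> and the term in
  \<open>y\<close> alone suffices.\<close>

lemma power_sum_bound:
  fixes \<epsilon> :: real
  assumes "\<epsilon> > 0"
  shows "\<exists>C\<ge>0. \<forall>x\<ge>0. \<forall>y\<ge>0. (x + y) ^ q \<le> (1 + \<epsilon>) * x ^ q + C * y ^ q"
proof -
  have "((\<lambda>t::real. (1 + t) ^ q) \<longlongrightarrow> (1 + 0) ^ q) (at_right 0)"
    by (intro tendsto_intros)
  then have "\<forall>\<^sub>F t in at_right 0. (1 + t) ^ q < 1 + \<epsilon>"
    by (rule order_tendstoD(2)) (use assms in simp)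
  then have "\<forall>\<^sub>F t in at_right 0. (1 + t) ^ q < 1 + \<epsilon> \<and> t > 0"
    using eventually_at_right_less[of "0::real"] by eventually_elim simp
  then obtain t where t: "(1 + t) ^ q < 1 + \<epsilon>" "t > 0"
    using eventually_happens'[OF trivial_limit_at_right_real] by blast
  have "(x + y) ^ q \<le> (1 + \<epsilon>) * x ^ q + (1 / t + 1) ^ q * y ^ q"
    if xy: "x \<ge> 0" "y \<ge> 0" for x y :: real
  proof (cases "y \<le> t * x")
    case True
    have "(x + y) ^ q \<le> ((1 + t) * x) ^ q"
      using xy True by (intro power_mono) (auto simp: algebra_simps)
    also have "\<dots> \<le> (1 + \<epsilon>) * x ^ q"
      unfolding power_mult_distrib by (rule mult_right_mono) (use t xy in simp_all)
    finally have "(x + y) ^ q \<le> (1 + \<epsilon>) * x ^ q" .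
    moreover have "(1 / t + 1) ^ q * y ^ q \<ge> 0" using xy t by simp
    ultimately show ?thesis by linarith
  next
    case False
    have "(x + y) ^ q \<le> ((1 / t + 1) * y) ^ q"
      using xy False t by (intro power_mono) (auto simp: field_simps)
    moreover have "(1 + \<epsilon>) * x ^ q \<ge> 0" using xy assms by simp
    ultimately show ?thesis unfolding power_mult_distrib by linarith
  qed
  moreover have "(1 / t + 1) ^ q \<ge> 0" using t by simp
  ultimately show ?thesis by blast
qed

lemma power_add_le:
  fixes x y :: real
  assumes "x \<ge> 0" "y \<ge> 0"
  shows "(x + y) ^ q \<le> 2 ^ q * (x ^ q + y ^ q)"
proof -
  have "(x + y) ^ q \<le> (2 * max x y) ^ q"
    using assms by (intro power_mono) auto
  also have "\<dots> = 2 ^ q * max x y ^ q" by (simp add: power_mult_distrib)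
  also have "\<dots> \<le> 2 ^ q * (x ^ q + y ^ q)"
    using assms by (intro mult_left_mono) (auto simp: max_def)
  finally show ?thesis .
qed

text \<open>A crude Young inequality, by comparison with the larger of \<open>x\<close> and
  \<open>y\<close>.\<close>

lemma mult_power_le:
  fixes x y :: real
  assumes "x \<ge> 0" "y \<ge> 0"
  shows "x * y ^ p \<le> x ^ Suc p + y ^ Suc p"
proof (cases "x \<le> y")
  case True
  then have "x * y ^ p \<le> y * y ^ p" using assms by (intro mult_right_mono) auto
  moreover have "x ^ Suc p \<ge> 0" using assms by simp
  ultimately show ?thesis by simp
next
  case False
  then have "x * y ^ p \<le> x * x ^ p" using assms by (intro mult_left_mono power_mono) auto
  moreover have "y ^ Suc p \<ge> 0" using assms by simp
  ultimately show ?thesis by simp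
qed

text \<open>The leaf height of the vertex at which the unary run ends, hence constant along a run.
  The subtraction never truncates, by \<open>unary_run_le_leaf_height\<close>.\<close>

definition base_height :: "plane_tree \<Rightarrow> nat" where
  "base_height T = leaf_height T - unary_run T"

lemma leaf_height_eq: "leaf_height T = base_height T + unary_run T"
  using unary_run_le_leaf_height[of T] by (simp add: base_height_def)

lemma base_height_unary [simp]: "base_height (Node [t]) = base_height t"
  by (simp add: base_height_def)

lemma fringe_sum_mono: "(\<And>t. g t \<le> (h t :: real)) \<Longrightarrow> fringe_sum g T \<le> fringe_sum h T"
  by (simp add: fringe_sum_def sum_mono)

text \<open>A run of length \<open>r\<close> ending at height \<open>z\<close> contributes
  \<open>r * z ^ p\<close>, which has degree \<open>p + 1\<close>; this is why the exponent
  \<open>q\<close> appears on the right.\<close>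

lemma fringe_sum_base_height:
  fixes p :: nat
  defines "q \<equiv> Suc p"
  shows "\<exists>C\<ge>0. \<forall>T. fringe_sum (\<lambda>t. real (base_height t) ^ p) T \<le>
           C * fringe_sum (\<lambda>t. 1 + real (unary_run t) ^ q) T"
proof -
  \<comment> \<open>The factor \<open>8 / 5\<close> is below 2: two children supply
    \<open>8 * z ^ q\<close> each, hence \<open>5 * x ^ q\<close> each up to errors. The total
    \<open>10 * x ^ q\<close> covers the potential \<open>9 * x ^ q\<close> of the parent and its
    contribution \<open>x ^ p\<close>.\<close>
  obtain C1 where C1: "C1 \<ge> 0"
    "\<And>x y :: real. \<lbrakk>x \<ge> 0; y \<ge> 0\<rbrakk> \<Longrightarrow> (x + y) ^ q \<le> 8 / 5 * x ^ q + C1 * y ^ q"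
    using power_sum_bound[of "3/5" q] by auto
  define C0 where "C0 = C1 * 2 ^ q"
  have C0: "(1 + x + y) ^ q \<le> 8 / 5 * x ^ q + C0 * (1 + y ^ q)" if "x \<ge> 0" "y \<ge> 0" for x y :: real
  proof -
    have "(1 + x + y) ^ q = (x + (1 + y)) ^ q" by (simp add: algebra_simps)
    also have "\<dots> \<le> 8 / 5 * x ^ q + C1 * (1 + y) ^ q" using that by (intro C1) auto
    also have "C1 * (1 + y) ^ q \<le> C1 * (2 ^ q * (1 ^ q + y ^ q))"
      using that C1 by (intro mult_left_mono power_add_le) auto
    finally show ?thesis by (simp add: C0_def algebra_simps)
  qed
  have "C0 \<ge> 0" using C1 by (simp add: C0_def)
  \<comment> \<open>The \<open>1\<close> is spent on the \<open>r ^ q\<close> that arises when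
    \<open>r * z ^ p\<close> is absorbed, and \<open>10 * C0\<close> on the two errors
    \<open>5 * C0 * (1 + r ^ q)\<close> at a branching vertex.\<close>
  define C where "C = 1 + 10 * C0"
  define F where "F = fringe_sum (\<lambda>t. real (base_height t) ^ p)"
  define S where "S = fringe_sum (\<lambda>t. 1 + real (unary_run t) ^ q)"
  let ?z = "\<lambda>t. real (base_height t)" and ?r = "\<lambda>t. real (unary_run t)"
  txt \<open>
    A branching vertex has two children whose heights both bound its own; their two potentials
    \<open>9 z\<^sup>q + C r\<^sup>q\<close> together pay for its potential and for its contribution to \<open>F\<close>.
    The term \<open>r z\<^sup>p\<close> is the contribution of the current unary run to \<open>F\<close>; it is absorbed by
    \<open>z\<^sup>q + r\<^sup>q\<close> at the next branching vertex above.
  \<close>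
  have "F T + 9 * ?z T ^ q + C * ?r T ^ q \<le> C * S T + ?r T * ?z T ^ p" for T
  proof (induction T)
    case (Node ts)
    have F: "F (Node ts) = ?z (Node ts) ^ p + sum_list (map F ts)"
      by (simp add: F_def fringe_sum_Node)
    have S: "S (Node ts) = 1 + ?r (Node ts) ^ q + sum_list (map S ts)"
      by (simp add: S_def fringe_sum_Node)
    show ?case
    proof (cases "length ts = 1")
      case True
      then obtain t where ts: "ts = [t]" by (auto simp: length_Suc_conv)
      then have "F t + 9 * ?z t ^ q + C * ?r t ^ q \<le> C * S t + ?r t * ?z t ^ p"
        using Node by simp
      moreover have "C * ?r t ^ q \<ge> 0" "C \<ge> 0" using \<open>C0 \<ge> 0\<close> by (auto simp: C_def)
      \<comment> \<open>At a unary vertex both sides gain \<open>z ^ p\<close>, and the terms in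
        \<open>C\<close> times the \<open>q\<close>-th power of the new run length cancel; what
        remains concerns \<open>t\<close> alone.\<close>
      ultimately have "F t + 9 * ?z t ^ q \<le> C + (C * S t + ?r t * ?z t ^ p)" by linarith
      then show ?thesis unfolding F S by (simp add: ts distrib_left distrib_right)
    next
      case False
      then have r0: "unary_run (Node ts) = 0" by (rule unary_run_eq_0)
      \<comment> \<open>Absorbing \<open>r * z ^ p\<close> lowers the coefficient of
        \<open>z ^ q\<close> from 9 to 8 and that of \<open>r ^ q\<close> from \<open>C\<close> to
        \<open>10 * C0\<close>.\<close>
      have child: "F t \<le> C * S t - (8 * ?z t ^ q + 10 * C0 * ?r t ^ q)" if "t \<in> set ts" for t
      proof -
        have "C * ?r t ^ q = ?r t ^ q + 10 * C0 * ?r t ^ q" by (simp add: C_def distrib_right)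
        then show ?thesis
          using Node[OF that] mult_power_le[of "?r t" "?z t" p, folded q_def] by simp
      qed
      show ?thesis
      proof (cases "ts = []")
        case True
        \<comment> \<open>At a leaf \<open>0 ^ p\<close> is 1 for \<open>p = 0\<close> and 0
          otherwise; \<open>C\<close> is at least 1 and covers both.\<close>
        then show ?thesis using \<open>C0 \<ge> 0\<close> unfolding F S
          by (auto simp: base_height_def q_def C_def power_0_left)
      next
        case nonempty: False
        with False obtain t1 t2 us where ts: "ts = t1 # t2 # us"
          by (cases ts rule: remdups_adj.cases) auto
        define x where "x = ?z (Node ts)"
        \<comment> \<open>This gives \<open>x ^ p \<le> x ^ q\<close> below.\<close>
        have "base_height (Node ts) \<ge> 1"
          using nonempty r0 by (simp add: base_height_def leaf_height.simps)
        then have x1: "x \<ge> 1" by (simp add: x_def)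
        have height: "5 * x ^ q \<le> 8 * ?z t ^ q + 5 * C0 * (1 + ?r t ^ q)" if "t \<in> set ts" for t
        proof -
          have "base_height (Node ts) \<le> 1 + base_height t + unary_run t"
            using leaf_height_le[OF that] r0 leaf_height_eq[of t] leaf_height_eq[of "Node ts"] by linarith
          then have "x \<le> 1 + ?z t + ?r t" by (simp add: x_def)
          then have "x ^ q \<le> (1 + ?z t + ?r t) ^ q" using x1 by (intro power_mono) auto
          also have "\<dots> \<le> 8 / 5 * ?z t ^ q + C0 * (1 + ?r t ^ q)" by (rule C0) auto
          finally show ?thesis by (simp add: algebra_simps)
        qed
        \<comment> \<open>Two children already pay for the parent, so the potentials of the others
          are dropped.\<close>
        have "sum_list (map F us) \<le> sum_list (map (\<lambda>t. C * S t) us)"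
        proof (rule sum_list_mono)
          fix t assume "t \<in> set us"
          then have "F t \<le> C * S t - (8 * ?z t ^ q + 10 * C0 * ?r t ^ q)" using ts by (intro child) auto
          moreover have "8 * ?z t ^ q + 10 * C0 * ?r t ^ q \<ge> 0" using \<open>C0 \<ge> 0\<close> by simp
          ultimately show "F t \<le> C * S t" by linarith
        qed
        then have us: "sum_list (map F us) \<le> C * sum_list (map S us)"
          by (simp add: sum_list_const_mult)
        have "x ^ p \<le> x ^ q" using x1 by (simp add: q_def power_increasing)
        moreover have "C0 * ?r t1 ^ q \<ge> 0" "C0 * ?r t2 ^ q \<ge> 0" using \<open>C0 \<ge> 0\<close> by auto
        moreover have "F t1 \<le> C * S t1 - (8 * ?z t1 ^ q + 10 * C0 * ?r t1 ^ q)"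
          "F t2 \<le> C * S t2 - (8 * ?z t2 ^ q + 10 * C0 * ?r t2 ^ q)"
          using child ts by simp_all
        moreover have "5 * x ^ q \<le> 8 * ?z t1 ^ q + 5 * (C0 * ?r t1 ^ q) + 5 * C0"
          "5 * x ^ q \<le> 8 * ?z t2 ^ q + 5 * (C0 * ?r t2 ^ q) + 5 * C0"
          using height[of t1] height[of t2] ts by (simp_all add: distrib_left)
        ultimately have "x ^ p + F t1 + F t2 + 9 * x ^ q \<le> C * S t1 + C * S t2 + C"
          using C_def by linarith
        moreover have "F (Node ts) = x ^ p + F t1 + F t2 + sum_list (map F us)"
          unfolding F by (simp add: ts x_def)
        moreover have "C * S (Node ts) = C + C * S t1 + C * S t2 + C * sum_list (map S us)"
          unfolding S using r0 by (simp add: ts q_def distrib_left)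
        moreover have "C * ?r (Node ts) ^ q = 0" "?r (Node ts) * x ^ p = 0"
          using r0 by (simp_all add: q_def)
        ultimately show ?thesis using us unfolding x_def by linarith
      qed
    qed
  qed note * = this
  have "F T \<le> C * S T" for T
  proof -
    have "C * ?r T ^ q \<ge> ?r T ^ q" using \<open>C0 \<ge> 0\<close> by (simp add: C_def algebra_simps)
    then show ?thesis
      using *[of T] mult_power_le[of "?r T" "?z T" p, folded q_def] zero_le_power[of "?z T" q]
      by linarith
  qed
  then show ?thesis using \<open>C0 \<ge> 0\<close> unfolding F_def S_def C_def by (intro exI[of _ "1 + 10 * C0"]) auto
qed
text \<open>Leaf height splits into base height and unary run; the first is handled by
  \<open>fringe_sum_base_height\<close>, the second is already of the form on the right.\<close>

lemma fringe_sum_protection_number: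
  "\<exists>C\<ge>0. \<forall>T. (\<Sum>v\<in>vertices T. real (protection_number T v) ^ p) \<le>
           C * fringe_sum (\<lambda>t. 1 + real (unary_run t) ^ Suc p) T"
proof -
  let ?S = "\<lambda>T. fringe_sum (\<lambda>t. 1 + real (unary_run t) ^ Suc p) T"
  obtain C where C: "C \<ge> 0" "\<And>T. fringe_sum (\<lambda>t. real (base_height t) ^ p) T \<le> C * ?S T"
    using fringe_sum_base_height by blast
  have "(\<Sum>v\<in>vertices T. real (protection_number T v) ^ p) \<le> 2 ^ p * (C + 1) * ?S T" for T
  proof -
    have "(\<Sum>v\<in>vertices T. real (protection_number T v) ^ p) \<le>
        fringe_sum (\<lambda>t. real (leaf_height t) ^ p) T"
      unfolding fringe_sum_def
      by (intro sum_mono power_mono) (auto simp: protection_number_le_leaf_height)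
    also have "\<dots> \<le> fringe_sum (\<lambda>t. 2 ^ p * (real (base_height t) ^ p + (1 + real (unary_run t) ^ Suc p))) T"
    proof (rule fringe_sum_mono)
      fix t
      have "real (leaf_height t) ^ p \<le> 2 ^ p * (real (base_height t) ^ p + real (unary_run t) ^ p)"
        unfolding leaf_height_eq of_nat_add by (rule power_add_le) auto
      \<comment> \<open>The summand 1 covers an empty run when \<open>p = 0\<close>, as
        \<open>0 ^ 0 = 1\<close>.\<close>
      moreover have "real (unary_run t) ^ p \<le> 1 + real (unary_run t) ^ Suc p"
      proof (cases "unary_run t = 0")
        case False
        then have "real (unary_run t) ^ p \<le> real (unary_run t) ^ Suc p"
          by (intro power_increasing) auto
        then show ?thesis by linarith
      qed (simp add: power_0_left)
      then have "2 ^ p * (real (base_height t) ^ p + real (unary_run t) ^ p) \<le>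
          2 ^ p * (real (base_height t) ^ p + (1 + real (unary_run t) ^ Suc p))"
        by (intro mult_left_mono add_left_mono) auto
      ultimately show "real (leaf_height t) ^ p \<le>
          2 ^ p * (real (base_height t) ^ p + (1 + real (unary_run t) ^ Suc p))"
        by linarith
    qed
    also have "\<dots> = 2 ^ p * (fringe_sum (\<lambda>t. real (base_height t) ^ p) T + ?S T)"
      by (simp add: fringe_sum_def sum.distrib flip: sum_distrib_left)
    also have "\<dots> \<le> 2 ^ p * (C * ?S T + ?S T)" using C by (intro mult_left_mono add_right_mono) auto
    finally show ?thesis by (simp only: distrib_right mult.assoc mult_1)
  qed
  then show ?thesis using C by (intro exI[of _ "2 ^ p * (C + 1)"]) auto
qed

section \<open>Growth of the partition function\<close>

lemma fringe_sum_add: "fringe_sum (\<lambda>t. f t + g t) T = fringe_sum f T + fringe_sum g T"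
  by (simp add: fringe_sum_def sum.distrib)

lemma tree_weight_nonneg: "weight_sequence \<omega> \<Longrightarrow> tree_weight \<omega> T \<ge> 0"
  by (auto simp: tree_weight_def weight_sequence_def intro: prod_nonneg)

lemma partition_function_nonneg: "weight_sequence \<omega> \<Longrightarrow> partition_function \<omega> n \<ge> 0"
  by (auto simp: partition_function_def intro: sum_nonneg tree_weight_nonneg)

lemma partition_function_pos:
  assumes "weight_sequence \<omega>" "sg_defined \<omega> n"
  shows "partition_function \<omega> n > 0"
proof -
  obtain T where "num_vertices T = n" "tree_weight \<omega> T > 0"
    using assms by (auto simp: sg_defined_def)
  then show ?thesis unfolding partition_function_def
    using assms by (intro sum_pos2[of _ T]) (auto simp: finite_num_vertices_eq tree_weight_nonneg)
qed

section \<open>Counting vertices by insertion\<close>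

lemma unary_run_ge_iff: "t \<in> range ((\<lambda>t. Node [t]) ^^ j) \<longleftrightarrow> j \<le> unary_run t"
proof (induction j arbitrary: t)
  case (Suc j)
  have *: "t \<in> range ((\<lambda>t. Node [t]) ^^ Suc j) \<longleftrightarrow>
      (\<exists>s. t = Node [s] \<and> s \<in> range ((\<lambda>t. Node [t]) ^^ j))"
    by (auto simp: image_iff)
  show ?case unfolding * Suc.IH by (cases t rule: unary_run.cases) auto
qed simp

text \<open>Insertion of a chain of \<open>j\<close> unary vertices: a vertex starts such a chain
  exactly if its run has length at least \<open>j\<close>.\<close>

lemma sum_weight_unary_run:
  "(\<Sum>T | num_vertices T = m + j. tree_weight \<omega> T * fringe_sum (\<lambda>t. of_bool (j \<le> unary_run t)) T) =
     \<omega> 1 ^ j * real m * partition_function \<omega> m"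
proof -
  let ?c = "(\<lambda>t. Node [t]) ^^ j"
  have "inj ?c" by (intro inj_fn) (auto simp: inj_on_def)
  moreover have "num_vertices (?c t) = num_vertices t + j" for t
    by (induction j) (auto simp: num_vertices_Node)
  moreover have "tree_weight \<omega> (?c t) = \<omega> 1 ^ j * tree_weight \<omega> t" for t
    by (induction j) (auto simp: tree_weight_Node)
  ultimately show ?thesis
    using sum_weight_insert[of ?c j \<omega> "\<omega> 1 ^ j" m] by (simp only: unary_run_ge_iff)
qed

text \<open>Grafting a unary root below every tree is injective.\<close>

lemma partition_function_unary_le:
  assumes "weight_sequence \<omega>"
  shows "\<omega> 1 * partition_function \<omega> n \<le> partition_function \<omega> (Suc n)"
proof -
  have "\<omega> 1 * partition_function \<omega> n = (\<Sum>T | num_vertices T = n. tree_weight \<omega> (Node [T]))"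
    by (simp add: partition_function_def sum_distrib_left tree_weight_Node)
  also have "\<dots> = (\<Sum>T\<in>(\<lambda>T. Node [T]) ` {T. num_vertices T = n}. tree_weight \<omega> T)"
    by (subst sum.reindex) (auto simp: inj_on_def)
  also have "\<dots> \<le> partition_function \<omega> (Suc n)"
    unfolding partition_function_def
    by (rule sum_mono2) (auto simp: finite_num_vertices_eq num_vertices_Node tree_weight_nonneg assms)
  finally show ?thesis .
qed

text \<open>No vertex is both unary and of the inserted shape \<open>?c t\<close>, so the two counts
  together are at most the number of vertices. Keeping \<open>t\<close> as the first child makes the
  insertion injective.\<close>

lemma partition_function_recurrence:
  assumes "weight_sequence \<omega>" "k \<ge> 2"
  shows "\<omega> k * \<omega> 0 ^ (k - 1) * real m * partition_function \<omega> m +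
           \<omega> 1 * real (m + k - 1) * partition_function \<omega> (m + k - 1)
         \<le> real (m + k) * partition_function \<omega> (m + k)"
proof -
  let ?c = "\<lambda>t. Node (t # replicate (k - 1) (Node []))"
  let ?N = "\<lambda>T. fringe_sum (\<lambda>t. of_bool (t \<in> range ?c)) T :: real"
  let ?U = "\<lambda>T. fringe_sum (\<lambda>t. of_bool (1 \<le> unary_run t)) T :: real"
  have leaf: "num_vertices (Node []) = 1" "tree_weight \<omega> (Node []) = \<omega> 0"
    by (simp_all add: num_vertices_Node tree_weight_Node)
  have 1: "(\<Sum>T | num_vertices T = m + k. tree_weight \<omega> T * ?N T) =
      \<omega> k * \<omega> 0 ^ (k - 1) * real m * partition_function \<omega> m"
    using assms by (intro sum_weight_insert)
      (auto simp: inj_on_def num_vertices_Node tree_weight_Node sum_list_replicate leaf)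
  have 2: "(\<Sum>T | num_vertices T = m + k. tree_weight \<omega> T * ?U T) =
      \<omega> 1 * real (m + k - 1) * partition_function \<omega> (m + k - 1)"
    using sum_weight_unary_run[where m = "m + k - 1" and j = 1 and \<omega> = \<omega>] assms by simp
  have "?N T + ?U T \<le> real (num_vertices T)" for T
  proof -
    have "unary_run (?c t) = 0" for t
      using assms by (intro unary_run_eq_0) auto
    then have "of_bool (t \<in> range ?c) + of_bool (1 \<le> unary_run t) \<le> (1::real)" for t
      by (auto simp: image_iff)
    then have "?N T + ?U T \<le> (\<Sum>v\<in>vertices T. 1)"
      unfolding fringe_sum_add[symmetric] unfolding fringe_sum_def by (rule sum_mono)
    then show ?thesis by (simp only: num_vertices_def sum_constant mult_1_right)
  qed
  then have "(\<Sum>T | num_vertices T = m + k. tree_weight \<omega> T * (?N T + ?U T)) \<le>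
      (\<Sum>T | num_vertices T = m + k. tree_weight \<omega> T * real (num_vertices T))"
    by (intro sum_mono mult_left_mono tree_weight_nonneg[OF assms(1)])
  also have "\<dots> = real (m + k) * partition_function \<omega> (m + k)"
    by (simp add: partition_function_def sum_distrib_left mult.commute)
  finally show ?thesis by (simp only: 1[symmetric] 2[symmetric] distrib_left sum.distrib)
qed

text \<open>The recurrence loses only a factor \<open>(n - 1) / n\<close> in one step but gains a
  fixed multiple of \<open>y (n - k)\<close>, which outweighs the loss for large \<open>n\<close>;
  so \<open>y\<close> grows by a fixed factor every \<open>k\<close> steps.\<close>

lemma geometric_decay:
  fixes y :: "nat \<Rightarrow> real"
  assumes nonneg: "\<And>n. y n \<ge> 0" and mono: "\<And>n. y n \<le> y (Suc n)"
    and c: "c > 0" and k: "k \<ge> 1"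
    and rec: "\<And>m. c * real m * y m + real (m + k - 1) * y (m + k - 1) \<le> real (m + k) * y (m + k)"
  shows "\<exists>C \<theta>. C > 0 \<and> 0 < \<theta> \<and> \<theta> < 1 \<and> (\<forall>n j. j \<le> n \<longrightarrow> y (n - j) \<le> C * \<theta> ^ j * y n)"
proof -
  have y_mono: "m \<le> n \<Longrightarrow> y m \<le> y n" for m n by (rule lift_Suc_mono_le[of y]) (rule mono)
  define \<delta> where "\<delta> = min 1 (c / 4)"
  have \<delta>: "\<delta> > 0" using c by (simp add: \<delta>_def)
  \<comment> \<open>The bound \<open>n \<ge> 2 * k\<close> gives \<open>n - k \<ge> n / 2\<close>,
    and \<open>n \<ge> 8 / c\<close> gives \<open>c * n / 4 \<ge> 2\<close>.\<close>
  define N where "N = max (2 * k) (nat \<lceil>8 / c\<rceil>)"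
  have step: "(1 + \<delta>) * y (n - k) \<le> y n" if n: "n \<ge> N" for n
  proof -
    have n1: "n \<ge> 2 * k" and "real n \<ge> 8 / c" using n by (auto simp: N_def intro: of_nat_ceiling[THEN order_trans])
    then have n2: "c * real n \<ge> 8" using c by (simp add: field_simps)
    define u v x where "u = y (n - k)" "v = y (n - 1)" "x = y n"
    have u: "0 \<le> u" "u \<le> v" using k nonneg by (auto simp: u_v_x_def intro: y_mono)
    have "c * real (n - k) * u + real (n - 1) * v \<le> real n * x"
      using rec[of "n - k"] n1 k by (simp add: u_v_x_def)
    moreover have "real (n - 1) = real n - 1" using n1 k by simp
    moreover have "c * (real n / 2) * u \<le> c * real (n - k) * u"
      using n1 u c by (intro mult_right_mono mult_left_mono) auto
    ultimately have *: "c * (real n / 2) * u + (real n - 1) * v \<le> real n * x" by simp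
    have n0: "real n > 0" using n1 k by simp
    have "(1 + \<delta>) * u \<le> x"
    \<comment> \<open>Either \<open>y\<close> has doubled already, or \<open>v < 2 * u\<close> and
      the lost \<open>v\<close> is paid by half of the gain \<open>c * (n / 2) * u\<close>; the
      other half is the \<open>c / 4\<close> in \<open>\<delta>\<close>.\<close>
    proof (cases "v \<ge> 2 * u")
      case True
      have "(1 + \<delta>) * u \<le> 2 * u" using u by (intro mult_right_mono) (auto simp: \<delta>_def)
      also have "\<dots> \<le> x" using True y_mono[of "n - 1" n] by (simp add: u_v_x_def)
      finally show ?thesis .
    next
      case False
      have "real n * ((1 + \<delta>) * u) \<le> real n * ((1 + c / 4) * u)"
        using u by (intro mult_left_mono mult_right_mono) (auto simp: \<delta>_def)
      also have "\<dots> = real n * u + (c * real n / 4) * u" by (simp add: algebra_simps)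
      also have "\<dots> \<le> real n * u + (c * real n / 2 - 2) * u"
        using n2 u by (intro add_left_mono mult_right_mono) auto
      also have "\<dots> \<le> real n * v + c * (real n / 2) * u - v"
        using mult_left_mono[OF u(2), of "real n"] False by (simp add: algebra_simps)
      also have "\<dots> \<le> real n * x" using * by (simp add: algebra_simps)
      finally show ?thesis using n0 by simp
    qed
    then show ?thesis by (simp add: u_v_x_def)
  qed
  define \<theta> where "\<theta> = root k (1 / (1 + \<delta>))"
  have \<theta>: "0 < \<theta>" "\<theta> < 1" "\<theta> ^ k = 1 / (1 + \<delta>)"
    using k \<delta> by (auto simp: \<theta>_def)
  \<comment> \<open>With this choice \<open>C * \<theta> ^ j \<ge> 1\<close> for
    \<open>j \<le> N + k\<close>, so monotonicity alone settles the cases where no step of length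
    \<open>k\<close> is available.\<close>
  define C where "C = 1 / \<theta> ^ (N + k)"
  have C: "C > 0" using \<theta> by (simp add: C_def)
  have "j \<le> n \<Longrightarrow> y (n - j) \<le> C * \<theta> ^ j * y n" for n j
  proof (induction n arbitrary: j rule: less_induct)
    case (less n)
    show ?case
    proof (cases "n \<ge> N \<and> j \<ge> k")
      case True
      have "y (n - k - (j - k)) \<le> C * \<theta> ^ (j - k) * y (n - k)"
        using less True k by (intro less.IH) auto
      moreover have "n - k - (j - k) = n - j" using True by simp
      moreover have "y (n - k) \<le> \<theta> ^ k * y n"
        using step[of n] True \<delta> by (simp add: \<theta> field_simps)
      then have "C * \<theta> ^ (j - k) * y (n - k) \<le> C * \<theta> ^ (j - k) * (\<theta> ^ k * y n)"
        using C \<theta> by (intro mult_left_mono) auto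
      moreover have "\<theta> ^ (j - k) * \<theta> ^ k = \<theta> ^ j" using True by (simp flip: power_add)
      ultimately show ?thesis by (simp add: mult.assoc) (simp flip: mult.assoc)
    next
      case False
      then have "j \<le> N + k" using less by auto
      then have "\<theta> ^ (N + k) \<le> \<theta> ^ j" using \<theta> by (intro power_decreasing) auto
      then have "1 \<le> C * \<theta> ^ j" using \<theta> by (simp add: C_def field_simps)
      then have "1 * y n \<le> C * \<theta> ^ j * y n" using nonneg by (intro mult_right_mono) auto
      then show ?thesis using y_mono[of "n - j" n] by simp
    qed
  qed
  then show ?thesis using C \<theta> by blast
qed

lemma num_vertices_fringe_le:
  assumes "v \<in> vertices T"
  shows "num_vertices (fringe_subtree T v) \<le> num_vertices T"
proof -
  have "is_vertex T v \<Longrightarrow> is_vertex (fringe_subtree T v) u \<Longrightarrow> is_vertex T (v @ u)" for u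
    by (induction v arbitrary: T) auto
  then have "(@) v ` vertices (fringe_subtree T v) \<subseteq> vertices T"
    using assms by (auto simp: vertices_def)
  then show ?thesis
    unfolding num_vertices_def by (intro card_inj_on_le[where f = "(@) v"]) (auto simp: inj_on_def)
qed

text \<open>After normalising to \<open>Z n / a ^ n\<close>, grafting a unary root gives
  monotonicity and the recurrence takes the form required by \<open>geometric_decay\<close>.\<close>

lemma partition_function_decay:
  assumes \<omega>: "weight_sequence \<omega>"
  shows "\<exists>C \<theta>. C > 0 \<and> 0 < \<theta> \<and> \<theta> < 1 \<and> (\<forall>n j. 1 \<le> j \<and> j \<le> n \<longrightarrow>
           \<omega> 1 ^ j * partition_function \<omega> (n - j) \<le> C * \<theta> ^ j * partition_function \<omega> n)"
proof (cases "\<omega> 1 = 0")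
  \<comment> \<open>Since \<open>j \<ge> 1\<close>, the left side vanishes, and any constants
    serve.\<close>
  case True
  then show ?thesis
    by (intro exI[of _ 1] exI[of _ "1/2"]) (auto simp: power_0_left partition_function_nonneg[OF \<omega>])
next
  case False
  define a where "a = \<omega> 1"
  have a: "a > 0" using False \<omega> by (auto simp: a_def weight_sequence_def less_le)
  obtain k where k: "k \<ge> 2" "\<omega> k > 0" using \<omega> by (auto simp: weight_sequence_def)
  have \<omega>0: "\<omega> 0 > 0" using \<omega> by (simp add: weight_sequence_def)
  define Z where "Z = partition_function \<omega>"
  define y where "y = (\<lambda>n. Z n / a ^ n)"
  define b where "b = \<omega> k * \<omega> 0 ^ (k - 1)"
  have "\<exists>C \<theta>. C > 0 \<and> 0 < \<theta> \<and> \<theta> < 1 \<and> (\<forall>n j. j \<le> n \<longrightarrow> y (n - j) \<le> C * \<theta> ^ j * y n)"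
  proof (rule geometric_decay)
    show "y n \<ge> 0" for n
      using a partition_function_nonneg[OF \<omega>] by (simp add: y_def Z_def)
    show "y n \<le> y (Suc n)" for n
      using a partition_function_unary_le[OF \<omega>, of n] by (simp add: y_def Z_def a_def field_simps)
    show "b / a ^ k > 0" using a k \<omega>0 by (simp add: b_def)
    show "k \<ge> 1" using k by simp
    fix m
    have "b * real m * Z m + a * real (m + k - 1) * Z (m + k - 1) \<le> real (m + k) * Z (m + k)"
      using partition_function_recurrence[OF \<omega> k(1), of m] by (simp add: b_def a_def Z_def)
    then have "(b * real m * Z m + a * real (m + k - 1) * Z (m + k - 1)) / a ^ (m + k) \<le>
        real (m + k) * Z (m + k) / a ^ (m + k)"
      using a by (intro divide_right_mono) auto
    moreover have "a ^ (m + k) = a * a ^ (m + k - 1)"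
      using k by (simp flip: power_Suc)
    then have "a * real (m + k - 1) * Z (m + k - 1) / a ^ (m + k) = real (m + k - 1) * y (m + k - 1)"
      using a by (simp add: y_def)
    moreover have "b * real m * Z m / a ^ (m + k) = b / a ^ k * real m * y m"
      by (simp add: y_def power_add)
    ultimately show "b / a ^ k * real m * y m + real (m + k - 1) * y (m + k - 1) \<le>
        real (m + k) * y (m + k)"
      by (simp only: add_divide_distrib y_def times_divide_eq_right)
  qed
  then obtain C \<theta> where C: "C > 0" "0 < \<theta>" "\<theta> < 1"
    and decay: "\<And>n j. j \<le> n \<Longrightarrow> y (n - j) \<le> C * \<theta> ^ j * y n" by blast
  have "a ^ j * Z (n - j) \<le> C * \<theta> ^ j * Z n" if "j \<le> n" for n j
  proof -
    have "a ^ n * y (n - j) \<le> a ^ n * (C * \<theta> ^ j * y n)"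
      using decay[OF that] a by (intro mult_left_mono) auto
    moreover have "a ^ n = a ^ j * a ^ (n - j)" using that by (simp flip: power_add)
    then have "a ^ n * y (n - j) = a ^ j * Z (n - j)" using a by (simp add: y_def)
    moreover have "a ^ n * (C * \<theta> ^ j * y n) = C * \<theta> ^ j * Z n" using a by (simp add: y_def)
    ultimately show ?thesis by simp
  qed
  then show ?thesis using C unfolding a_def Z_def by blast
qed

lemma summable_power_times_geometric:
  fixes \<theta> :: real
  assumes "0 < \<theta>" "\<theta> < 1"
  shows "summable (\<lambda>j. real j ^ q * \<theta> ^ j)"
proof (rule summable_comparison_test_bigo)
  show "summable (\<lambda>j. norm (1 / real j ^ 2))"
    using inverse_power_summable[of 2] by (simp add: divide_inverse)
  show "(\<lambda>j. real j ^ q * \<theta> ^ j) \<in> O(\<lambda>j. 1 / real j ^ 2)"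
    using assms by real_asymp
qed

section \<open>Moments and uniform integrability\<close>

text \<open>The power \<open>r ^ q\<close> is bounded by the sum of \<open>j ^ q\<close> over
  \<open>1 \<le> j \<le> r\<close>, of which it is one term. This exposes the counts of runs of
  length at least \<open>j\<close>, whose geometric decay makes the sum over \<open>j\<close>
  converge uniformly in \<open>n\<close>.\<close>

lemma unary_run_moment:
  assumes \<omega>: "weight_sequence \<omega>"
  shows "\<exists>C\<ge>0. \<forall>n. (\<Sum>T | num_vertices T = n.
           tree_weight \<omega> T * fringe_sum (\<lambda>t. 1 + real (unary_run t) ^ Suc p) T) \<le>
         C * (real n * partition_function \<omega> n)"
proof -
  obtain C \<theta> where C: "C > 0" and \<theta>: "0 < \<theta>" "\<theta> < 1"
    and decay: "\<And>n j. 1 \<le> j \<Longrightarrow> j \<le> n \<Longrightarrow>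
      \<omega> 1 ^ j * partition_function \<omega> (n - j) \<le> C * \<theta> ^ j * partition_function \<omega> n"
    using partition_function_decay[OF \<omega>] by blast
  define q where "q = Suc p"
  define D where "D = (\<Sum>j. real j ^ q * \<theta> ^ j)"
  note summable = summable_power_times_geometric[OF \<theta>, of q]
  have D: "D \<ge> 0" unfolding D_def using \<theta> by (intro suminf_nonneg summable) auto
  have "(\<Sum>T | num_vertices T = n. tree_weight \<omega> T * fringe_sum (\<lambda>t. 1 + real (unary_run t) ^ q) T)
      \<le> (1 + C * D) * (real n * partition_function \<omega> n)" (is "?lhs \<le> _") for n
  proof -
    let ?Z = "partition_function \<omega>"
    let ?R = "\<lambda>j T. fringe_sum (\<lambda>t. of_bool (j \<le> unary_run t)) T :: real"
    have fringe: "fringe_sum (\<lambda>t. 1 + real (unary_run t) ^ q) T \<le>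
        real n + (\<Sum>j=1..n. real j ^ q * ?R j T)" if T: "num_vertices T = n" for T
    proof -
      have "fringe_sum (\<lambda>t. 1 + real (unary_run t) ^ q) T =
          real n + (\<Sum>v\<in>vertices T. real (unary_run (fringe_subtree T v)) ^ q)"
        using T by (simp add: fringe_sum_def sum.distrib num_vertices_def)
      also have "(\<Sum>v\<in>vertices T. real (unary_run (fringe_subtree T v)) ^ q) \<le>
          (\<Sum>v\<in>vertices T. \<Sum>j=1..n. real j ^ q * of_bool (j \<le> unary_run (fringe_subtree T v)))"
      proof (rule sum_mono)
        fix v assume v: "v \<in> vertices T"
        let ?r = "unary_run (fringe_subtree T v)"
        show "real ?r ^ q \<le> (\<Sum>j=1..n. real j ^ q * of_bool (j \<le> ?r))"
        proof (cases "?r = 0")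
          case False
          have "?r \<le> n"
            using unary_run_less_num_vertices[of "fringe_subtree T v"] num_vertices_fringe_le[OF v] T
            by simp
          then show ?thesis
            using False member_le_sum[of ?r "{1..n}" "\<lambda>j. real j ^ q * of_bool (j \<le> ?r)"] by simp
        qed (simp add: q_def)
      qed
      also have "\<dots> = (\<Sum>j=1..n. real j ^ q * ?R j T)"
        unfolding fringe_sum_def sum_distrib_left by (rule sum.swap)
      finally show ?thesis by simp
    qed
    have "?lhs \<le> (\<Sum>T | num_vertices T = n.
        tree_weight \<omega> T * (real n + (\<Sum>j=1..n. real j ^ q * ?R j T)))"
      by (intro sum_mono mult_left_mono fringe tree_weight_nonneg[OF \<omega>]) simp
    also have "\<dots> = real n * ?Z n +
        (\<Sum>T | num_vertices T = n. \<Sum>j=1..n. real j ^ q * (tree_weight \<omega> T * ?R j T))"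
      by (simp add: partition_function_def distrib_left sum.distrib sum_distrib_left mult_ac)
    also have "(\<Sum>T | num_vertices T = n. \<Sum>j=1..n. real j ^ q * (tree_weight \<omega> T * ?R j T)) =
        (\<Sum>j=1..n. real j ^ q * (\<Sum>T | num_vertices T = n. tree_weight \<omega> T * ?R j T))"
      unfolding sum_distrib_left by (rule sum.swap)
    also have "\<dots> \<le> (\<Sum>j=1..n. C * (real n * ?Z n) * (real j ^ q * \<theta> ^ j))"
    proof (rule sum_mono)
      fix j assume j: "j \<in> {1..n}"
      have "(\<Sum>T | num_vertices T = n. tree_weight \<omega> T * ?R j T) =
          real (n - j) * (\<omega> 1 ^ j * ?Z (n - j))"
        using sum_weight_unary_run[where m = "n - j" and j = j and \<omega> = \<omega>] j by simp
      also have "\<dots> \<le> real n * (C * \<theta> ^ j * ?Z n)"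
        using j \<omega> by (intro mult_mono decay)
          (auto intro!: mult_nonneg_nonneg partition_function_nonneg simp: weight_sequence_def)
      finally have "real j ^ q * (\<Sum>T | num_vertices T = n. tree_weight \<omega> T * ?R j T) \<le>
          real j ^ q * (real n * (C * \<theta> ^ j * ?Z n))"
        by (intro mult_left_mono) auto
      then show "real j ^ q * (\<Sum>T | num_vertices T = n. tree_weight \<omega> T * ?R j T) \<le>
          C * (real n * ?Z n) * (real j ^ q * \<theta> ^ j)"
        by (simp only: mult_ac)
    qed
    also have "\<dots> \<le> C * (real n * ?Z n) * D"
      unfolding sum_distrib_left[symmetric] D_def
      using \<theta> C partition_function_nonneg[OF \<omega>]
      by (intro mult_left_mono sum_le_suminf summable) auto
    finally show ?thesis by (simp add: algebra_simps)
  qed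
  then show ?thesis using C D unfolding q_def by (intro exI[of _ "1 + C * D"]) auto
qed

text \<open>Every vertex of a tree of size \<open>n\<close> has conditional probability
  \<open>1 / n\<close>, so the pairs of tree and vertex have total mass
  \<open>real n * partition_function \<omega> n\<close> before normalisation.\<close>

lemma nn_integral_sg_tree_vertex:
  assumes \<omega>: "weight_sequence \<omega>" and n: "sg_defined \<omega> n" and f: "\<And>T v. f T v \<ge> 0"
  shows "(\<integral>\<^sup>+(T, v). ennreal (f T v) \<partial>measure_pmf (sg_tree_vertex \<omega> n)) =
    ennreal ((\<Sum>T | num_vertices T = n. tree_weight \<omega> T * (\<Sum>v\<in>vertices T. f T v)) /
      (real n * partition_function \<omega> n))"
proof -
  let ?Z = "partition_function \<omega> n"
  have Z: "?Z > 0" by (rule partition_function_pos[OF \<omega> n])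
  have inner: "(\<integral>\<^sup>+v. ennreal (f T v) \<partial>measure_pmf (pmf_of_set (vertices T))) =
      ennreal ((\<Sum>v\<in>vertices T. f T v) / real (num_vertices T))" for T
  proof -
    have "vertices T \<noteq> {}" by (auto intro: Nil_in_vertices)
    then have "(\<integral>\<^sup>+v. ennreal (f T v) \<partial>measure_pmf (pmf_of_set (vertices T))) =
        (\<Sum>v\<in>vertices T. ennreal (f T v)) / of_nat (num_vertices T)"
      by (simp add: nn_integral_pmf_of_set num_vertices_def)
    also have "\<dots> = ennreal ((\<Sum>v\<in>vertices T. f T v) / real (num_vertices T))"
      using f num_vertices_pos[of T]
      by (simp add: ennreal_of_nat_eq_real_of_nat divide_ennreal sum_nonneg)
    finally show ?thesis .
  qed
  have "(\<integral>\<^sup>+(T, v). ennreal (f T v) \<partial>measure_pmf (sg_tree_vertex \<omega> n)) =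
      (\<integral>\<^sup>+T. ennreal ((\<Sum>v\<in>vertices T. f T v) / real (num_vertices T)) \<partial>measure_pmf (sg_tree \<omega> n))"
    by (simp add: sg_tree_vertex_def inner)
  also have "\<dots> = (\<Sum>T | num_vertices T = n.
      ennreal ((\<Sum>v\<in>vertices T. f T v) / real (num_vertices T)) * ennreal (pmf (sg_tree \<omega> n) T))"
    by (rule nn_integral_measure_pmf_support)
      (auto simp: finite_num_vertices_eq set_pmf_iff pmf_sg_tree[OF \<omega> n])
  also have "\<dots> = (\<Sum>T | num_vertices T = n.
      ennreal (tree_weight \<omega> T * (\<Sum>v\<in>vertices T. f T v) / (real n * ?Z)))"
    using Z f tree_weight_nonneg[OF \<omega>]
    by (intro sum.cong) (auto simp: pmf_sg_tree[OF \<omega> n] sum_nonneg mult_ac simp flip: ennreal_mult)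
  also have "\<dots> = ennreal (\<Sum>T | num_vertices T = n.
      tree_weight \<omega> T * (\<Sum>v\<in>vertices T. f T v) / (real n * ?Z))"
    using Z f tree_weight_nonneg[OF \<omega>] by (intro sum_ennreal) (auto simp: sum_nonneg)
  finally show ?thesis by (simp add: sum_divide_distrib)
qed

text \<open>The deterministic bound is averaged over trees; the factor
  \<open>real n * partition_function \<omega> n\<close> in \<open>unary_run_moment\<close> cancels
  the normalisation.\<close>

lemma protection_number_moment:
  assumes \<omega>: "weight_sequence \<omega>"
  shows "\<exists>C\<ge>0. \<forall>n. sg_defined \<omega> n \<longrightarrow>
    (\<integral>\<^sup>+(T, v). ennreal (real (protection_number T v) ^ p) \<partial>measure_pmf (sg_tree_vertex \<omega> n)) \<le> ennreal C"
proof -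
  let ?S = "\<lambda>T. fringe_sum (\<lambda>t. 1 + real (unary_run t) ^ Suc p) T"
  obtain C1 where C1: "C1 \<ge> 0"
    "\<And>T. (\<Sum>v\<in>vertices T. real (protection_number T v) ^ p) \<le> C1 * ?S T"
    using fringe_sum_protection_number by blast
  obtain C2 where C2: "C2 \<ge> 0"
    "\<And>n. (\<Sum>T | num_vertices T = n. tree_weight \<omega> T * ?S T) \<le> C2 * (real n * partition_function \<omega> n)"
    using unary_run_moment[OF \<omega>] by blast
  have "(\<integral>\<^sup>+(T, v). ennreal (real (protection_number T v) ^ p) \<partial>measure_pmf (sg_tree_vertex \<omega> n)) \<le>
      ennreal (C1 * C2)" if n: "sg_defined \<omega> n" for n
  proof -
    let ?Z = "partition_function \<omega> n"
    have "n > 0" using n num_vertices_pos by (auto simp: sg_defined_def)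
    then have pos: "real n * ?Z > 0" using partition_function_pos[OF \<omega> n] by simp
    have "(\<Sum>T | num_vertices T = n. tree_weight \<omega> T * (\<Sum>v\<in>vertices T. real (protection_number T v) ^ p)) \<le>
        (\<Sum>T | num_vertices T = n. tree_weight \<omega> T * (C1 * ?S T))"
      by (intro sum_mono mult_left_mono C1(2) tree_weight_nonneg[OF \<omega>])
    also have "\<dots> = C1 * (\<Sum>T | num_vertices T = n. tree_weight \<omega> T * ?S T)"
      by (simp only: sum_distrib_left mult_ac)
    also have "\<dots> \<le> C1 * (C2 * (real n * ?Z))" using C1 C2 by (intro mult_left_mono) auto
    finally show ?thesis
      using pos by (subst nn_integral_sg_tree_vertex[OF \<omega> n])
        (auto intro!: ennreal_leI simp: pos_divide_le_eq mult.assoc)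
  qed
  then show ?thesis using C1 C2 by (intro exI[of _ "C1 * C2"]) auto
qed

section \<open>Real exponents and uniform integrability\<close>

lemma rpow_of_nat_le: "rpow (real k) p \<le> 1 + real k ^ nat \<lceil>p\<rceil>"
proof (cases "k = 0 \<or> p = 0")
  case False
  have "real k powr p \<le> real k powr real (nat \<lceil>p\<rceil>)"
    using False by (intro powr_mono) (auto simp: real_nat_ceiling_ge)
  then show ?thesis using False by (simp add: rpow_def powr_realpow)
qed (auto simp: rpow_def)

lemma rpow_power2: "rpow x p ^ 2 = rpow x (2 * p)"
  by (simp add: rpow_def power2_eq_square flip: powr_add)

lemma protection_number_rpow_moment:
  assumes \<omega>: "weight_sequence \<omega>"
  shows "\<exists>C\<ge>0. \<forall>n. sg_defined \<omega> n \<longrightarrow>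
    (\<integral>\<^sup>+(T, v). ennreal (rpow (real (protection_number T v)) p) \<partial>measure_pmf (sg_tree_vertex \<omega> n)) \<le> ennreal C"
proof -
  define N where "N = nat \<lceil>p\<rceil>"
  obtain C where C: "C \<ge> 0" "\<And>n. sg_defined \<omega> n \<Longrightarrow>
      (\<integral>\<^sup>+(T, v). ennreal (real (protection_number T v) ^ N) \<partial>measure_pmf (sg_tree_vertex \<omega> n)) \<le> ennreal C"
    using protection_number_moment[OF \<omega>] by blast
  have "(\<integral>\<^sup>+(T, v). ennreal (rpow (real (protection_number T v)) p) \<partial>measure_pmf (sg_tree_vertex \<omega> n)) \<le>
      ennreal (1 + C)" if n: "sg_defined \<omega> n" for n
  proof -
    have "(\<integral>\<^sup>+(T, v). ennreal (rpow (real (protection_number T v)) p) \<partial>measure_pmf (sg_tree_vertex \<omega> n)) \<le>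
        (\<integral>\<^sup>+x. 1 + (case x of (T, v) \<Rightarrow> ennreal (real (protection_number T v) ^ N)) \<partial>measure_pmf (sg_tree_vertex \<omega> n))"
      using rpow_of_nat_le[of _ p, folded N_def]
      by (intro nn_integral_mono) (auto simp del: ennreal_plus simp flip: ennreal_1 ennreal_plus intro!: ennreal_leI)
    also have "\<dots> = 1 + (\<integral>\<^sup>+(T, v). ennreal (real (protection_number T v) ^ N) \<partial>measure_pmf (sg_tree_vertex \<omega> n))"
      by (subst nn_integral_add) auto
    also have "\<dots> \<le> 1 + ennreal C" using C(2)[OF n] by (intro add_left_mono)
    finally show ?thesis using C by simp
  qed
  then show ?thesis using C by (intro exI[of _ "1 + C"]) auto
qed

text \<open>Where \<open>\<bar>X\<bar> > K\<close>, one has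
  \<open>\<bar>X\<bar> \<le> X\<^sup>2 / K\<close>, so the tails are at most \<open>C / K\<close>
  uniformly in the index.\<close>

lemma uniformly_integrableI_second_moment:
  assumes meas: "\<And>i. i \<in> I \<Longrightarrow> X i \<in> borel_measurable (M i)"
    and C: "C \<ge> 0" "\<And>i. i \<in> I \<Longrightarrow> (\<integral>\<^sup>+x. ennreal ((X i x)\<^sup>2) \<partial>M i) \<le> ennreal C"
  shows "uniformly_integrable I M X"
proof -
  let ?F = "\<lambda>K::real. SUP i\<in>I. \<integral>\<^sup>+x. ennreal \<bar>X i x\<bar> * indicator {x. \<bar>X i x\<bar> > K} x \<partial>M i"
  have le: "?F K \<le> ennreal (C / K)" if K: "K > 0" for K
  proof (rule SUP_least)
    fix i assume i: "i \<in> I"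
    have [measurable]: "X i \<in> borel_measurable (M i)" by (rule meas[OF i])
    have "(\<integral>\<^sup>+x. ennreal \<bar>X i x\<bar> * indicator {x. \<bar>X i x\<bar> > K} x \<partial>M i) \<le>
        (\<integral>\<^sup>+x. ennreal (1 / K) * ennreal ((X i x)\<^sup>2) \<partial>M i)"
    proof (rule nn_integral_mono)
      fix x
      show "ennreal \<bar>X i x\<bar> * indicator {x. \<bar>X i x\<bar> > K} x \<le> ennreal (1 / K) * ennreal ((X i x)\<^sup>2)"
      proof (cases "\<bar>X i x\<bar> > K")
        case True
        then have "K * \<bar>X i x\<bar> \<le> \<bar>X i x\<bar> * \<bar>X i x\<bar>" by (intro mult_right_mono) auto
        then have "\<bar>X i x\<bar> \<le> 1 / K * (X i x)\<^sup>2"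
          using K by (simp add: field_simps power2_eq_square)
        then show ?thesis using True K by (simp add: ennreal_leI flip: ennreal_mult)
      qed simp
    qed
    also have "\<dots> = ennreal (1 / K) * (\<integral>\<^sup>+x. ennreal ((X i x)\<^sup>2) \<partial>M i)"
      by (rule nn_integral_cmult) simp
    also have "\<dots> \<le> ennreal (1 / K) * ennreal C" by (intro mult_left_mono C(2) i) simp
    also have "\<dots> = ennreal (C / K)" using K C by (simp flip: ennreal_mult)
    finally show "(\<integral>\<^sup>+x. ennreal \<bar>X i x\<bar> * indicator {x. \<bar>X i x\<bar> > K} x \<partial>M i) \<le> ennreal (C / K)" .
  qed
  have "((\<lambda>K. C / K) \<longlongrightarrow> 0) at_top" by real_asymp
  then have "((\<lambda>K. ennreal (C / K)) \<longlongrightarrow> 0) at_top"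
    using tendsto_ennrealI by fastforce
  moreover have "\<forall>\<^sub>F K in at_top. ?F K \<le> ennreal (C / K)"
    using eventually_gt_at_top[of 0] by eventually_elim (rule le)
  ultimately have "(?F \<longlongrightarrow> 0) at_top"
    by (intro tendsto_sandwich[of "\<lambda>_. 0" ?F at_top "\<lambda>K. ennreal (C / K)"]) auto
  then show ?thesis using meas unfolding uniformly_integrable_def by blast
qed

theorem lemma5p4:
  fixes \<omega> :: "nat \<Rightarrow> real"
  assumes "weight_sequence \<omega>"
    and "type_I \<omega> \<or> type_II \<omega> \<or> type_III \<omega>"
  shows "(\<exists>n\<^sub>0\<ge>1. \<forall>p::real. p \<ge> 0 \<longrightarrow>
            (SUP n\<in>{n. n \<ge> n\<^sub>0 \<and> sg_defined \<omega> n}.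
               \<integral>\<^sup>+(T, v). ennreal (rpow (real (protection_number T v)) p)
                 \<partial>measure_pmf (sg_tree_vertex \<omega> n)) < \<infinity>)
       \<and> (\<forall>p::real. p \<ge> 0 \<longrightarrow>
            uniformly_integrable {n. n \<ge> 1 \<and> sg_defined \<omega> n}
              (\<lambda>n. measure_pmf (sg_tree_vertex \<omega> n))
              (\<lambda>n (T, v). rpow (real (protection_number T v)) p))"
\<comment> \<open>The moment bounds hold for every \<open>n\<close> with
  \<open>sg_defined \<omega> n\<close>, so the threshold 1 serves for all \<open>p\<close>.\<close>
proof (intro conjI exI[of _ "1::nat"] allI impI)
  fix p :: real
  obtain C where "C \<ge> 0" "\<And>n. sg_defined \<omega> n \<Longrightarrow>
      (\<integral>\<^sup>+(T, v). ennreal (rpow (real (protection_number T v)) p) \<partial>measure_pmf (sg_tree_vertex \<omega> n)) \<le> ennreal C"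
    using protection_number_rpow_moment[OF assms(1)] by blast
  then have "(SUP n\<in>{n. n \<ge> 1 \<and> sg_defined \<omega> n}.
      \<integral>\<^sup>+(T, v). ennreal (rpow (real (protection_number T v)) p)
        \<partial>measure_pmf (sg_tree_vertex \<omega> n)) \<le> ennreal C"
    by (intro SUP_least) auto
  then show "(SUP n\<in>{n. n \<ge> 1 \<and> sg_defined \<omega> n}.
      \<integral>\<^sup>+(T, v). ennreal (rpow (real (protection_number T v)) p)
        \<partial>measure_pmf (sg_tree_vertex \<omega> n)) < \<infinity>"
    by (rule le_less_trans) simp
next
  fix p :: real
  \<comment> \<open>The second moment of the \<open>p\<close>-th power is the moment of order
    \<open>2 * p\<close>.\<close>
  obtain C where C: "C \<ge> 0" "\<And>n. sg_defined \<omega> n \<Longrightarrow>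
      (\<integral>\<^sup>+(T, v). ennreal (rpow (real (protection_number T v)) (2 * p)) \<partial>measure_pmf (sg_tree_vertex \<omega> n)) \<le> ennreal C"
    using protection_number_rpow_moment[OF assms(1)] by blast
  show "uniformly_integrable {n. n \<ge> 1 \<and> sg_defined \<omega> n}
      (\<lambda>n. measure_pmf (sg_tree_vertex \<omega> n))
      (\<lambda>n (T, v). rpow (real (protection_number T v)) p)"
    using C by (intro uniformly_integrableI_second_moment[where C = C])
      (auto simp: rpow_power2 split_def)
qed simp

end
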